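(* Let $f:\mathcal{X}\to\mathbb{R}$ be a convex differentiable function on the open domain $\mathcal{X}$ that is closed (all sublevel sets $\{\mathbf{x}\in\mathcal{X}: f(\mathbf{x})\le a\}$, $a\in\mathbb{R}$, are closed), and suppose $f\in\mathcal{F}_{\ell}(\|\cdot\|)$ with $\ell$ sub-quadratic, i.e. $\lim_{\alpha\to\infty}\alpha^2/\ell(\alpha)=\infty$. Let $\mathbf{y}_0=\mathbf{x}_0=\operatorname{argmin}_{\mathbf{x}\in\mathcal{X}}\psi(\mathbf{x})$ and $$G:=\sup\{\alpha\in\mathbb{R}_+ : \alpha^2\le 2\ell(2\alpha)(f(\mathbf{x}_0)-f^* )\},\qquad L:=\ell(2G).$$ Let $0<\eta\le 1/(3L)$ and let the iterates be generated by optimistic mirror descent: for $t\in\mathbb{N}_+$, $$\mathbf{y}_t=\mathcal{P}_{\mathbf{x}_{t-1}}(\eta\nabla f(\mathbf{y}_{t-1})),\qquad \mathbf{x}_t=\mathcal{P}_{\mathbf{x}_{t-1}}(\eta\nabla f(\mathbf{y}_t)).$$ Then $\max\{\|\nabla f(\mathbf{y}_t)\|_*,\|\nabla f(\mathbf{x}_t)\|_*\}\le G$ for all $t\in\mathbb{N}$, and for every $T\in\mathbb{N}_+$, with $\overline{\mathbf{y}}_T=\frac1T\sum_{t=1}^T\mathbf{y}_t$, $$f(\overline{\mathbf{y}}_T)-f^*\le\frac{B(\mathbf{x}_*,\mathbf{x}_0)}{\eta T}.$$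
   Context: $\mathcal{E}$ is a finite-dimensional real Banach space with norm $\|\cdot\|$, dual space $\mathcal{E}^*$ and dual norm $\|\mathbf{u}\|_*:=\sup\{\langle\mathbf{u},\mathbf{y}\rangle:\|\mathbf{y}\|\le1\}$. $\mathcal{X}\subseteq\mathcal{E}$ is convex. $\mathbb{R}_+$ (resp. $\mathbb{R}_{++}$) is the set of nonnegative (resp. positive) reals; $\mathbb{N}$ includes $0$ and $\mathbb{N}_+$ is the set of positive integers. $\mathbf{x}_*\in\operatorname{argmin}_{\mathbf{x}\in\mathcal{X}}f(\mathbf{x})$ is a minimizer (assumed to exist) and $f^*=f(\mathbf{x}_* )$. $\ell*$-smoothness: for a non-decreasing continuous $\ell:\mathbb{R}_+\to\mathbb{R}_{++}$, a differentiable $f:\mathcal{X}\to\mathbb{R}$ belongs to $\mathcal{F}_\ell(\|\cdot\|)$ if for almost every $\mathbf{x}\in\mathcal{X}$: $\|\nabla^2f(\mathbf{x})\mathbf{h}\|_*\le\ell(\|\nabla f(\mathbf{x})\|_* )\|\mathbf{h}\|$ for all $\mathbf{h}\in\mathcal{X}$. Mirror map: $\psi:\mathcal{X}\to\mathbb{R}_+$ is a continuous distance-generating function: $\mathcal{X}^o=\{\mathbf{x}\in\mathcal{X}:\partial\psi(\mathbf{x})\ne\emptyset\}$ is convex, $\psi$ is continuously differentiable and $1$-strongly convex w.r.t. $\|\cdot\|$, i.e. $\langle\nabla\psi(\mathbf{x}_1)-\nabla\psi(\mathbf{x}_2),\mathbf{x}_1-\mathbf{x}_2\rangle\ge\|\mathbf{x}_1-\mathbf{x}_2\|^2$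 for $\mathbf{x}_1,\mathbf{x}_2\in\mathcal{X}^o$. Bregman function: $B(\mathbf{x},\mathbf{x}^o)=\psi(\mathbf{x})-\psi(\mathbf{x}^o)-\langle\nabla\psi(\mathbf{x}^o),\mathbf{x}-\mathbf{x}^o\rangle$ for $\mathbf{x}\in\mathcal{X},\mathbf{x}^o\in\mathcal{X}^o$. Prox-mapping: $\mathcal{P}_{\mathbf{y}}(\mathbf{g}):=\operatorname{argmin}_{\mathbf{x}\in\mathcal{X}}\{\langle\mathbf{g},\mathbf{x}\rangle+B(\mathbf{x},\mathbf{y})\}$; the argmins defining $\mathbf{x}_0$ and the iterates are assumed to be attained.
   Formalization: In the definition of F_ℓ, ∇f is additionally required to be locally Lipschitz on X (the a.e. Hessian bound alone admits Cantor-type counterexamples), and the Hessian bound is required for all directions h in E rather than only h in X (the literal version is also false). *)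

theory Defs
  imports "HOL-Analysis.Analysis"
begin

text \<open>
  A finite-dimensional normed space is modelled as a Euclidean space \<open>'a\<close>, which supplies the vector
  space, its (unique) topology and its Lebesgue null sets, together with an arbitrary norm \<open>N\<close> on
  it. The dual space is identified with \<open>'a\<close> by means of the pairing \<open>u \<bullet> x\<close>, so that gradients are
  vectors that are measured in the dual norm of \<open>N\<close>. The Euclidean norm plays no other role.
\<close>

definition is_norm :: "('a::real_vector \<Rightarrow> real) \<Rightarrow> bool" where
  "is_norm N \<longleftrightarrow>
     (\<forall>x. 0 \<le> N x) \<and> (\<forall>x. N x = 0 \<longleftrightarrow> x = 0) \<and>
     (\<forall>c x. N (c *\<^sub>R x) = \<bar>c\<bar> * N x) \<and> (\<forall>x y. N (x + y) \<le> N x + N y)"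

definition dual_norm :: "('a::real_inner \<Rightarrow> real) \<Rightarrow> 'a \<Rightarrow> real" where
  "dual_norm N u = Sup {u \<bullet> y | y. N y \<le> 1}"

text \<open>Meaningful only where a gradient exists. It depends on the values of \<open>f\<close> near \<open>x\<close> alone, so
  that for an open domain the values of \<open>f\<close> outside of it are irrelevant.\<close>

definition grad :: "('a::real_inner \<Rightarrow> real) \<Rightarrow> 'a \<Rightarrow> 'a" where
  "grad f x = (THE D. GDERIV f x :> D)"

lemma grad_eq:
  assumes "GDERIV f x :> D"
  shows "grad f x = D"
proof -
  have "D' = D" if "GDERIV f x :> D'" for D'
  proof -
    have "(\<lambda>h. h \<bullet> D') = (\<lambda>h. h \<bullet> D)"
      using that assms unfolding gderiv_def by (rule has_derivative_unique)
    then show ?thesis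
      by (metis vector_eq_ldot)
  qed
  with assms show ?thesis
    unfolding grad_def by blast
qed

definition closed_function :: "'a::topological_space set \<Rightarrow> ('a \<Rightarrow> real) \<Rightarrow> bool" where
  "closed_function X f \<longleftrightarrow> (\<forall>a. closed {x \<in> X. f x \<le> a})"

definition link_function :: "(real \<Rightarrow> real) \<Rightarrow> bool" where
  "link_function l \<longleftrightarrow> mono_on {0..} l \<and> continuous_on {0..} l \<and> (\<forall>a\<ge>0. 0 < l a)"

definition sub_quadratic :: "(real \<Rightarrow> real) \<Rightarrow> bool" where
  "sub_quadratic l \<longleftrightarrow> filterlim (\<lambda>a. a\<^sup>2 / l a) at_top at_top"

text \<open>
  The class \<open>\<F>\<^sub>l\<close> on an open set \<open>X\<close>. The Hessian is the derivative of the gradient map. An almost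
  everywhere bound on it carries information only if it controls the increments of the gradient:
  for a convex \<open>f\<close> on the line whose derivative is a Cantor function, the second derivative vanishes
  almost everywhere, so that \<open>f\<close> would satisfy the bound for every \<open>l\<close>. As usual, ``the Hessian
  exists almost everywhere'' is therefore read as ``the gradient is locally Lipschitz'' (Rademacher).
  For a convex differentiable \<open>f\<close>, whose gradient is continuous, this is the same as reading the
  Hessian as a weak derivative, since \<open>l (\<parallel>\<nabla>f\<parallel>)\<close> is then locally bounded. By equivalence of norms,
  local Lipschitz continuity does not depend on the norms used. The argument \<open>h\<close> is a direction and
  ranges over the whole space, so that the bound is one on the operator norm of the Hessian.
\<close>

definition ell_star_smooth ::
    "('a::euclidean_space \<Rightarrow> real) \<Rightarrow> (real \<Rightarrow> real) \<Rightarrow> 'a set \<Rightarrow> ('a \<Rightarrow> real) \<Rightarrow> bool" where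
  "ell_star_smooth N l X f \<longleftrightarrow>
     (\<forall>x\<in>X. f differentiable (at x)) \<and>
     (\<forall>x\<in>X. \<exists>r>0. \<exists>C. C-lipschitz_on (ball x r \<inter> X) (grad f)) \<and>
     (AE x in lebesgue. x \<in> X \<longrightarrow>
        grad f differentiable (at x) \<and>
        (\<forall>h. dual_norm N (frechet_derivative (grad f) (at x) h) \<le> l (dual_norm N (grad f x)) * N h))"

definition subdifferential :: "'a::real_inner set \<Rightarrow> ('a \<Rightarrow> real) \<Rightarrow> 'a \<Rightarrow> 'a set" where
  "subdifferential X \<psi> x = {g. \<forall>z\<in>X. \<psi> x + g \<bullet> (z - x) \<le> \<psi> z}"

definition subdiff_domain :: "'a::real_inner set \<Rightarrow> ('a \<Rightarrow> real) \<Rightarrow> 'a set" where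
  "subdiff_domain X \<psi> = {x \<in> X. subdifferential X \<psi> x \<noteq> {}}"

text \<open>Intended for an open \<open>X\<close>, where the gradient of \<open>\<psi>\<close> is an ordinary two-sided one.\<close>

definition mirror_map :: "('a::euclidean_space \<Rightarrow> real) \<Rightarrow> 'a set \<Rightarrow> ('a \<Rightarrow> real) \<Rightarrow> bool" where
  "mirror_map N X \<psi> \<longleftrightarrow>
     continuous_on X \<psi> \<and> (\<forall>x\<in>X. 0 \<le> \<psi> x) \<and>
     convex (subdiff_domain X \<psi>) \<and>
     (\<forall>x\<in>subdiff_domain X \<psi>. \<psi> differentiable (at x)) \<and>
     continuous_on (subdiff_domain X \<psi>) (grad \<psi>) \<and>
     (\<forall>x1\<in>subdiff_domain X \<psi>. \<forall>x2\<in>subdiff_domain X \<psi>.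
        (N (x1 - x2))\<^sup>2 \<le> (grad \<psi> x1 - grad \<psi> x2) \<bullet> (x1 - x2))"

definition bregman :: "('a::real_inner \<Rightarrow> real) \<Rightarrow> 'a \<Rightarrow> 'a \<Rightarrow> real" where
  "bregman \<psi> x y = \<psi> x - \<psi> y - grad \<psi> y \<bullet> (x - y)"

text \<open>The prox-mapping as the set of minimisers: \<open>z \<in> prox X \<psi> y g\<close> says that the argmin is attained
  at \<open>z\<close>. Under \<^const>\<open>mirror_map\<close> with open \<open>X\<close> there is at most one minimiser.\<close>

definition prox :: "'a::real_inner set \<Rightarrow> ('a \<Rightarrow> real) \<Rightarrow> 'a \<Rightarrow> 'a \<Rightarrow> 'a set" where
  "prox X \<psi> y g = {z. is_arg_min (\<lambda>x. g \<bullet> x + bregman \<psi> x y) (\<lambda>x. x \<in> X) z}"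

end

theory Submission
  imports Defs
begin

text \<open>
  Each iterate solves the first-order condition of its prox step, and \<open>\<psi>\<close> is strongly convex, so
  consecutive iterates are close. By closedness and local smoothness the squared gradient norm is
  controlled by the function gap (a self-bounding inequality), which makes \<open>G\<close> a bound for the
  gradient on the sublevel set of \<open>x 0\<close>. A Lyapunov argument keeps all iterates in this set, where \<open>f\<close>
  behaves like an \<open>L\<close>-smooth function, and the usual regret bound for optimistic mirror descent
  telescopes.
\<close>

section \<open>Norms and dual norms\<close>

text \<open>The obstacle is a circle: \<open>L\<close> controls \<open>grad f\<close> only where the
  gradient is bounded, the gradient is bounded on the sublevel set, and staying in the sublevel set
  is proved by smoothness. It is broken by a bound on distances that does not mention function
  values: from a point of gradient norm at most \<open>G\<close>, a segment in \<open>X\<close> of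
  length at most \<open>G / L\<close> leads to gradients of norm at most \<open>2 * G\<close>. Hence
  \<open>L = l (2 * G)\<close> and the argument \<open>2 * \<alpha>\<close> in the set defining
  \<open>G\<close>. The step size \<open>1 / (3 * L)\<close> makes the moves of one iteration fit
  into that range.

  The Lyapunov function needs its quadratic term because each step uses a gradient taken at another
  point, and the resulting error is quadratic in the distance of the paired iterates. Openness of
  \<open>X\<close> turns optimality in a prox step into an equation for \<open>grad \<psi>\<close>,
  without a normal cone.\<close>

lemma is_norm_simps:
  assumes "is_norm N"
  shows "0 \<le> N x" "N x = 0 \<longleftrightarrow> x = 0" "N 0 = 0" "N (c *\<^sub>R x) = \<bar>c\<bar> * N x"
    "N (x + y) \<le> N x + N y" "N (- x) = N x"
proof -
  show "0 \<le> N x" "N x = 0 \<longleftrightarrow> x = 0" "N 0 = 0" "N (x + y) \<le> N x + N y"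
    using assms by (simp_all add: is_norm_def)
  show scale: "N (c *\<^sub>R x) = \<bar>c\<bar> * N x" for c
    using assms by (simp add: is_norm_def)
  show "N (- x) = N x"
    using scale[of "-1"] by simp
qed

lemma is_norm_minus_commute:
  assumes "is_norm N"
  shows "N (x - y) = N (y - x)"
  using is_norm_simps(6)[OF assms, of "x - y"] by simp

lemma is_norm_triangle:
  assumes "is_norm N"
  shows "N (x - z) \<le> N (x - y) + N (y - z)"
  using is_norm_simps(5)[OF assms, of "x - y" "y - z"] by simp

text \<open>A norm is convex, and a finite convex function on an open set of a finite-dimensional
  space is continuous.\<close>

lemma is_norm_continuous_on:
  fixes N :: "'a::euclidean_space \<Rightarrow> real"
  assumes "is_norm N"
  shows "continuous_on S N"
proof -
  have "convex_on UNIV N"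
  proof (rule convex_onI)
    fix t :: real and x y assume "0 < t" "t < 1"
    then show "N ((1 - t) *\<^sub>R x + t *\<^sub>R y) \<le> (1 - t) * N x + t * N y"
      using is_norm_simps(5)[OF assms, of "(1 - t) *\<^sub>R x" "t *\<^sub>R y"]
      by (simp add: is_norm_simps(4)[OF assms])
  qed simp
  then have "continuous_on UNIV N"
    by (rule convex_on_continuous[OF open_UNIV])
  then show ?thesis
    using continuous_on_subset by blast
qed

lemma is_norm_dominates_norm:
  fixes N :: "'a::euclidean_space \<Rightarrow> real"
  assumes "is_norm N"
  obtains m where "m > 0" "\<And>x. m * norm x \<le> N x"
proof -
  have "\<exists>z\<in>sphere (0::'a) 1. \<forall>x\<in>sphere 0 1. N z \<le> N x"
    by (rule continuous_attains_inf) (auto intro: is_norm_continuous_on[OF assms])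
  then obtain z where z: "norm z = 1" "\<And>x. norm x = 1 \<Longrightarrow> N z \<le> N x"
    by (auto simp: dist_norm)
  have "N z > 0"
    using z(1) is_norm_simps(1,2)[OF assms, of z] by (auto simp: less_le)
  moreover have "N z * norm x \<le> N x" for x
  proof (cases "x = 0")
    case False
    then have "N z \<le> N ((1 / norm x) *\<^sub>R x)"
      by (intro z(2)) simp
    also have "\<dots> = N x / norm x"
      by (simp add: is_norm_simps(4)[OF assms])
    finally show ?thesis
      using False by (simp add: field_simps)
  qed (simp add: is_norm_simps[OF assms])
  ultimately show ?thesis
    using that by blast
qed

lemma compact_is_norm_ball:
  fixes N :: "'a::euclidean_space \<Rightarrow> real"
  assumes "is_norm N"
  shows "compact {y. N y \<le> 1}"
proof -
  obtain m where m: "m > 0" "\<And>x. m * norm x \<le> N x"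
    using is_norm_dominates_norm[OF assms] by blast
  have "closed {y. N y \<le> 1}"
    by (intro closed_Collect_le is_norm_continuous_on[OF assms] continuous_on_const)
  moreover have "norm y \<le> 1 / m" if "N y \<le> 1" for y
    using m(2)[of y] m(1) that by (simp add: field_simps)
  then have "bounded {y. N y \<le> 1}"
    by (auto intro: boundedI)
  ultimately show ?thesis
    by (simp add: compact_eq_bounded_closed)
qed

text \<open>A real \<open>Sup\<close> says something only about a nonempty set that is bounded
  above. Compactness of the unit ball of \<open>N\<close> gives this and a maximiser, which later
  serves as a direction of steepest descent.\<close>

lemma dual_norm_attained:
  fixes N :: "'a::euclidean_space \<Rightarrow> real"
  assumes "is_norm N"
  shows "\<exists>v. N v \<le> 1 \<and> dual_norm N u = u \<bullet> v \<and> (\<forall>y. N y \<le> 1 \<longrightarrow> u \<bullet> y \<le> dual_norm N u)"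
proof -
  have "{y. N y \<le> 1} \<noteq> {}"
    using is_norm_simps(3)[OF assms] by (metis empty_iff mem_Collect_eq zero_le_one)
  then have "\<exists>v\<in>{y. N y \<le> 1}. \<forall>y\<in>{y. N y \<le> 1}. u \<bullet> y \<le> u \<bullet> v"
    by (intro continuous_attains_sup compact_is_norm_ball[OF assms] continuous_intros)
  then obtain v where v: "N v \<le> 1" "\<And>y. N y \<le> 1 \<Longrightarrow> u \<bullet> y \<le> u \<bullet> v"
    by auto
  then have "dual_norm N u = u \<bullet> v"
    unfolding dual_norm_def by (intro cSup_eq_maximum) auto
  then show ?thesis
    using v by auto
qed

lemma inner_le_dual_norm:
  fixes N :: "'a::euclidean_space \<Rightarrow> real"
  assumes "is_norm N"
  shows "u \<bullet> y \<le> dual_norm N u * N y"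
proof (cases "y = 0")
  case False
  then have pos: "N y > 0"
    using is_norm_simps(1,2)[OF assms, of y] by (simp add: less_le)
  then have "N ((1 / N y) *\<^sub>R y) \<le> 1"
    by (simp add: is_norm_simps(4)[OF assms])
  then have "u \<bullet> ((1 / N y) *\<^sub>R y) \<le> dual_norm N u"
    using dual_norm_attained[OF assms] by blast
  then show ?thesis
    using pos by (simp add: field_simps)
qed (simp add: is_norm_simps(3)[OF assms])

lemma dual_norm_le:
  fixes N :: "'a::euclidean_space \<Rightarrow> real"
  assumes "is_norm N" "\<And>y. N y \<le> 1 \<Longrightarrow> u \<bullet> y \<le> c"
  shows "dual_norm N u \<le> c"
  using dual_norm_attained[OF assms(1), of u] assms(2) by auto

lemma is_norm_dual_norm:
  fixes N :: "'a::euclidean_space \<Rightarrow> real"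
  assumes "is_norm N"
  shows "is_norm (dual_norm N)"
proof -
  note inner_le = inner_le_dual_norm[OF assms]
  have nonneg: "0 \<le> dual_norm N u" for u
    using dual_norm_attained[OF assms, of u] is_norm_simps(3)[OF assms]
    by (auto dest!: spec[of _ 0])
  have unit: "u \<bullet> y \<le> dual_norm N u" if "N y \<le> 1" for u y
    using dual_norm_attained[OF assms, of u] that by blast
  \<comment> \<open>The reverse inequality will be this one for \<open>1 / c\<close> and
    \<open>c *\<^sub>R u\<close>.\<close>
  have scale_le: "dual_norm N (c *\<^sub>R u) \<le> \<bar>c\<bar> * dual_norm N u" for c u
  proof (rule dual_norm_le[OF assms])
    fix y assume "N y \<le> 1"
    have "(c *\<^sub>R u) \<bullet> y = u \<bullet> (c *\<^sub>R y)"
      by simp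
    also have "\<dots> \<le> dual_norm N u * (\<bar>c\<bar> * N y)"
      using inner_le[of u "c *\<^sub>R y"] by (simp add: is_norm_simps(4)[OF assms])
    also have "\<dots> \<le> dual_norm N u * (\<bar>c\<bar> * 1)"
      using \<open>N y \<le> 1\<close> nonneg by (intro mult_left_mono) auto
    finally show "(c *\<^sub>R u) \<bullet> y \<le> \<bar>c\<bar> * dual_norm N u"
      by (simp add: mult.commute)
  qed
  have "u = 0" if "dual_norm N u = 0" for u
    using inner_le[of u u] that inner_ge_zero[of u] by (metis inner_eq_zero_iff mult_zero_left order_antisym)
  moreover have "dual_norm N 0 = 0"
    using scale_le[of 0 0] nonneg[of 0] by simp
  moreover have "dual_norm N (c *\<^sub>R u) = \<bar>c\<bar> * dual_norm N u" for c u
  proof (cases "c = 0")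
    case False
    then have "\<bar>c\<bar> * dual_norm N u \<le> dual_norm N (c *\<^sub>R u)"
      using scale_le[of "1 / c" "c *\<^sub>R u"] by (simp add: field_simps)
    then show ?thesis
      using scale_le[of c u] by simp
  qed (simp add: \<open>dual_norm N 0 = 0\<close>)
  moreover have "dual_norm N (u + v) \<le> dual_norm N u + dual_norm N v" for u v
    by (rule dual_norm_le[OF assms]) (simp add: inner_add_left add_mono unit)
  ultimately show ?thesis
    unfolding is_norm_def using nonneg by blast
qed

section \<open>Increments of the gradient along segments\<close>

text \<open>If the increment exceeded \<open>C * (b - a)\<close>, some \<open>\<theta> t = \<phi> t - C' * t\<close> with \<open>C' > C\<close> would
  increase from \<open>a\<close> to \<open>b\<close>. The last time at which \<open>\<theta>\<close> takes an intermediate value is not a point of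
  negative derivative, hence lies in \<open>E\<close>; so \<open>\<theta> ` E\<close> contains an interval, although it is
  negligible as a Lipschitz image of a negligible set.\<close>

lemma increment_le_of_deriv_le_off_negligible:
  fixes \<phi> :: "real \<Rightarrow> real"
  assumes "a \<le> b" and "negligible E"
    and lips: "\<And>t. t \<in> {a..b} \<Longrightarrow> \<exists>r>0. \<exists>K. \<forall>s\<in>{a..b}. \<bar>s - t\<bar> < r \<longrightarrow> \<bar>\<phi> s - \<phi> t\<bar> \<le> K * \<bar>s - t\<bar>"
    and deriv: "\<And>t. t \<in> {a<..<b} - E \<Longrightarrow> \<exists>D\<le>C. (\<phi> has_real_derivative D) (at t)"
  shows "\<phi> b - \<phi> a \<le> C * (b - a)"
proof (rule ccontr)
  assume contra: "\<not> ?thesis"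
  then have "a < b"
    using \<open>a \<le> b\<close> by (cases "a = b") auto
  have "C < (\<phi> b - \<phi> a) / (b - a)"
    using contra \<open>a < b\<close> by (simp add: less_divide_eq)
  then obtain C' where "C < C'" "C' < (\<phi> b - \<phi> a) / (b - a)"
    using dense by blast
  define \<theta> where "\<theta> t = \<phi> t - C' * t" for t
  have "C' * (b - a) < \<phi> b - \<phi> a"
    using \<open>C' < _\<close> \<open>a < b\<close> by (simp add: less_divide_eq)
  then have less: "\<theta> a < \<theta> b"
    by (simp add: \<theta>_def algebra_simps)
  have \<theta>_lips: "\<exists>r>0. \<exists>K. \<forall>s\<in>{a..b}. \<bar>s - t\<bar> < r \<longrightarrow> \<bar>\<theta> s - \<theta> t\<bar> \<le> K * \<bar>s - t\<bar>" if t: "t \<in> {a..b}" for t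
  proof -
    obtain r K where r: "r > 0" and K: "\<And>s. s \<in> {a..b} \<Longrightarrow> \<bar>s - t\<bar> < r \<Longrightarrow> \<bar>\<phi> s - \<phi> t\<bar> \<le> K * \<bar>s - t\<bar>"
      using lips[OF t] by blast
    have "\<bar>\<theta> s - \<theta> t\<bar> \<le> (K + \<bar>C'\<bar>) * \<bar>s - t\<bar>" if "s \<in> {a..b}" "\<bar>s - t\<bar> < r" for s
    proof -
      have "\<theta> s - \<theta> t = (\<phi> s - \<phi> t) - C' * (s - t)"
        by (simp add: \<theta>_def algebra_simps)
      then have "\<bar>\<theta> s - \<theta> t\<bar> \<le> \<bar>\<phi> s - \<phi> t\<bar> + \<bar>C' * (s - t)\<bar>"
        by (metis abs_triangle_ineq4)
      also have "\<dots> \<le> K * \<bar>s - t\<bar> + \<bar>C'\<bar> * \<bar>s - t\<bar>"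
        using K[OF that] by (simp add: abs_mult)
      finally show ?thesis
        by (simp add: algebra_simps)
    qed
    with r show ?thesis
      by blast
  qed
  have cont: "continuous_on {a..b} \<theta>"
    unfolding continuous_on_eq_continuous_within
  proof
    fix t assume t: "t \<in> {a..b}"
    obtain r K where r: "r > 0" and K: "\<And>s. s \<in> {a..b} \<Longrightarrow> \<bar>s - t\<bar> < r \<Longrightarrow> \<bar>\<theta> s - \<theta> t\<bar> \<le> K * \<bar>s - t\<bar>"
      using \<theta>_lips[OF t] by blast
    have "((\<lambda>s. \<theta> s - \<theta> t) \<longlongrightarrow> 0) (at t within {a..b})"
    proof (rule Lim_null_comparison)
      show "\<forall>\<^sub>F s in at t within {a..b}. norm (\<theta> s - \<theta> t) \<le> K * \<bar>s - t\<bar>"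
        unfolding eventually_at using r K by (auto simp: dist_real_def intro!: exI[of _ r])
      have "((\<lambda>s. K * \<bar>s - t\<bar>) \<longlongrightarrow> K * \<bar>t - t\<bar>) (at t within {a..b})"
        by (intro tendsto_intros)
      then show "((\<lambda>s. K * \<bar>s - t\<bar>) \<longlongrightarrow> 0) (at t within {a..b})"
        by simp
    qed
    then show "continuous (at t within {a..b}) \<theta>"
      unfolding continuous_within using LIM_zero_cancel by blast
  qed
  have "{\<theta> a<..<\<theta> b} \<subseteq> \<theta> ` (E \<inter> {a..b})"
  proof
    fix c assume c: "c \<in> {\<theta> a<..<\<theta> b}"
    define S where "S = {t \<in> {a..b}. \<theta> t \<le> c}"
    have "compact S"
      unfolding S_def compact_eq_bounded_closed
      by (intro conjI continuous_on_closed_Collect_le cont continuous_on_const closed_atLeastAtMost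
          bounded_subset[OF bounded_closed_interval[of a b]] Collect_restrict)
    moreover have "S \<noteq> {}"
      using c \<open>a < b\<close> by (auto simp: S_def intro!: exI[of _ a])
    ultimately obtain t where t: "t \<in> S" and max: "\<And>s. s \<in> S \<Longrightarrow> s \<le> t"
      using compact_attains_sup[of S] by blast
    have tb: "a \<le> t" "t \<le> b" "\<theta> t \<le> c"
      using t by (auto simp: S_def)
    have gt: "c < \<theta> s" if "t < s" "s \<le> b" for s
      using max[of s] that tb by (force simp: S_def)
    have "\<exists>s\<ge>t. s \<le> b \<and> \<theta> s = c"
      using tb c by (intro IVT' continuous_on_subset[OF cont]) auto
    then have "\<theta> t = c"
      using gt by force
    then have "t \<in> {a<..<b}"
      using c tb by (cases "t = a"; cases "t = b") auto
    have "t \<in> E"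
    proof (rule ccontr)
      assume "t \<notin> E"
      then obtain D where D: "D \<le> C" "(\<phi> has_real_derivative D) (at t)"
        using deriv \<open>t \<in> {a<..<b}\<close> by blast
      have "(\<theta> has_real_derivative D - C') (at t)"
        unfolding \<theta>_def by (rule derivative_eq_intros D(2) refl | simp)+
      moreover have "D - C' < 0"
        using D(1) \<open>C < C'\<close> by simp
      ultimately obtain d where d: "d > 0" "\<And>h. 0 < h \<Longrightarrow> h < d \<Longrightarrow> \<theta> (t + h) < \<theta> t"
        using DERIV_neg_dec_right by blast
      define h where "h = min (d / 2) (b - t)"
      have "0 < h" "h < d" "t + h \<le> b"
        using d(1) \<open>t \<in> {a<..<b}\<close> by (auto simp: h_def)
      then show False
        using d(2)[of h] gt[of "t + h"] \<open>\<theta> t = c\<close> by simp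
    qed
    then show "c \<in> \<theta> ` (E \<inter> {a..b})"
      using \<open>\<theta> t = c\<close> tb by auto
  qed
  moreover have "negligible (\<theta> ` (E \<inter> {a..b}))"
  proof (rule negligible_locally_Lipschitz_image)
    show "negligible (E \<inter> {a..b})"
      using \<open>negligible E\<close> negligible_subset by blast
    fix t assume "t \<in> E \<inter> {a..b}"
    then obtain r K where "r > 0" "\<And>s. s \<in> {a..b} \<Longrightarrow> \<bar>s - t\<bar> < r \<Longrightarrow> \<bar>\<theta> s - \<theta> t\<bar> \<le> K * \<bar>s - t\<bar>"
      using \<theta>_lips[of t] by blast
    then show "\<exists>T B. open T \<and> t \<in> T \<and> (\<forall>s\<in>E \<inter> {a..b} \<inter> T. norm (\<theta> s - \<theta> t) \<le> B * norm (s - t))"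
      by (intro exI[of _ "ball t r"] exI[of _ K]) (auto simp: dist_real_def abs_minus_commute)
  qed simp
  ultimately have "negligible {\<theta> a<..<\<theta> b}"
    using negligible_subset by blast
  then show False
    using less open_not_negligible[of "{\<theta> a<..<\<theta> b}"] by auto
qed

text \<open>For fixed \<open>t\<close> the exceptional \<open>z\<close> form a translate of
  \<open>E\<close>, hence a null set. Exchanging the quantifiers is Fubini, for which
  \<open>E\<close> is Borel.\<close>

lemma AE_line_avoids_null_set:
  fixes h :: "'a::euclidean_space"
  assumes "E \<in> null_sets lborel"
  shows "AE z in lborel. AE t in lborel. z + t *\<^sub>R h \<notin> E"
proof -
  have [measurable]: "E \<in> sets borel"
    using assms by auto
  have "AE z in lborel. z + t *\<^sub>R h \<notin> E" for t :: real
  proof -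
    have "{z. z - (- t *\<^sub>R h) \<in> E} \<in> null_sets lborel"
      by (rule null_sets_translation[OF assms])
    then show ?thesis
      by (rule AE_I') auto
  qed
  then have "AE t in lborel. AE z in lborel. z + t *\<^sub>R h \<notin> E"
    by simp
  then show ?thesis
    by (subst lborel_pair.AE_commute) measurable
qed

section \<open>Gradients, lines and segments\<close>

lemma GDERIV_grad:
  fixes f :: "'a::euclidean_space \<Rightarrow> real"
  assumes "f differentiable (at x)"
  shows "GDERIV f x :> grad f x"
proof -
  obtain f' where f': "(f has_derivative f') (at x)"
    using assms differentiable_def by blast
  \<comment> \<open>Riesz representation of the functional \<open>f'\<close>.\<close>
  have "f' = (\<lambda>h. h \<bullet> adjoint f' 1)"
    using adjoint_works[OF has_derivative_linear[OF f']] by simp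
  then have "GDERIV f x :> adjoint f' 1"
    using f' unfolding gderiv_def by simp
  then show ?thesis
    using grad_eq by metis
qed

lemma DERIV_line_grad:
  fixes f :: "'a::euclidean_space \<Rightarrow> real"
  assumes "f differentiable (at (x + t *\<^sub>R h))"
  shows "((\<lambda>s. f (x + s *\<^sub>R h)) has_real_derivative grad f (x + t *\<^sub>R h) \<bullet> h) (at t)"
proof -
  have "((\<lambda>s. x + s *\<^sub>R h) has_derivative (\<lambda>s. s *\<^sub>R h)) (at t)"
    by (auto intro!: derivative_eq_intros)
  then have "((\<lambda>s. f (x + s *\<^sub>R h)) has_derivative (\<lambda>s. (s *\<^sub>R h) \<bullet> grad f (x + t *\<^sub>R h))) (at t)"
    using GDERIV_grad[OF assms] unfolding gderiv_def by (rule has_derivative_compose)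
  then show ?thesis
    by (simp add: has_field_derivative_def inner_commute mult_commute_abs)
qed

lemma closed_segment_plus_subset:
  assumes "0 \<le> s" "\<And>u. 0 \<le> u \<Longrightarrow> u \<le> s \<Longrightarrow> x + u *\<^sub>R h \<in> S"
  shows "closed_segment x (x + s *\<^sub>R h) \<subseteq> S"
proof
  fix y assume "y \<in> closed_segment x (x + s *\<^sub>R h)"
  then obtain u where u: "0 \<le> u" "u \<le> 1" "y = (1 - u) *\<^sub>R x + u *\<^sub>R (x + s *\<^sub>R h)"
    unfolding in_segment by blast
  have "y = x + (u * s) *\<^sub>R h"
    by (simp add: u(3) algebra_simps)
  moreover have "u * s \<le> s"
    using u assms(1) by (simp add: mult_left_le_one_le)
  ultimately show "y \<in> S"
    using assms u(1) by simp
qed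

lemma closed_segment_plusI:
  assumes "0 \<le> u" "u \<le> 1"
  shows "a + u *\<^sub>R (b - a) \<in> closed_segment a b"
  unfolding in_segment using assms by (intro exI[of _ u]) (simp add: algebra_simps)

text \<open>A nonempty open set is not negligible, so it cannot lie inside an exceptional null
  set.\<close>

lemma AE_lborel_ex_in_open:
  fixes V :: "'a::euclidean_space set"
  assumes "AE z in lborel. P z" "open V" "V \<noteq> {}"
  shows "\<exists>z\<in>V. P z"
proof (rule ccontr)
  assume none: "\<not> ?thesis"
  obtain E where E: "E \<in> null_sets lborel" "{z. \<not> P z} \<subseteq> E"
    using assms(1) by (auto simp: eventually_ae_filter)
  have "negligible E"
    using E(1) by (simp add: negligible_iff_null_sets null_sets_completionI)
  then have "negligible V"
    using E(2) none by (auto intro: negligible_subset)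
  then show False
    using open_not_negligible assms(2,3) by blast
qed

lemma ell_star_smooth_continuous_on_grad:
  assumes "open X" "ell_star_smooth N l X f"
  shows "continuous_on X (grad f)"
  unfolding continuous_on_eq_continuous_at[OF \<open>open X\<close>]
proof
  fix x assume "x \<in> X"
  then obtain r C where "r > 0" "C-lipschitz_on (ball x r \<inter> X) (grad f)"
    using assms(2) unfolding ell_star_smooth_def by blast
  then have "continuous_on (ball x r \<inter> X) (grad f)" "x \<in> ball x r \<inter> X" "open (ball x r \<inter> X)"
    using \<open>x \<in> X\<close> assms(1) by (auto intro: lipschitz_on_continuous_on)
  then show "continuous (at x) (grad f)"
    using continuous_on_eq_continuous_at by blast
qed

text \<open>The bound on the Hessian may fail on all of a given segment, but by Fubini almost every
  translate of it meets the exceptional null set in a null set of parameters only.\<close>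

lemma grad_increment_le:
  fixes N :: "'a::euclidean_space \<Rightarrow> real"
  assumes N: "is_norm N" and "open X" and l: "link_function l" and smooth: "ell_star_smooth N l X f"
    and seg: "closed_segment a b \<subseteq> {x \<in> X. dual_norm N (grad f x) < M}"
  shows "dual_norm N (grad f b - grad f a) \<le> l M * N (b - a)"
proof (rule ccontr)
  assume contra: "\<not> ?thesis"
  let ?g = "grad f" and ?D = "dual_norm N"
  define h where "h = b - a"
  note D = is_norm_dual_norm[OF N]
  note cont = ell_star_smooth_continuous_on_grad[OF \<open>open X\<close> smooth]
  \<comment> \<open>The strict bound makes \<open>U\<close> open. Compactness of the segment then
    yields a tube of uniform radius \<open>e\<close> inside \<open>U\<close>, which contains all
    nearby translates.\<close>
  define U where "U = {x \<in> X. ?D (?g x) < M}"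
  have contD: "continuous_on X (\<lambda>x. ?D (?g x))"
    by (rule continuous_on_compose2[OF is_norm_continuous_on[OF D, of UNIV] cont]) simp
  then have "open (X \<inter> (\<lambda>x. ?D (?g x)) -` {..<M})"
    by (rule continuous_open_preimage[OF _ \<open>open X\<close> open_lessThan])
  moreover have "U = X \<inter> (\<lambda>x. ?D (?g x)) -` {..<M}"
    by (auto simp: U_def)
  ultimately have "open U"
    by simp
  then obtain e where "e > 0" and e: "(\<Union>x\<in>closed_segment a b. ball x e) \<subseteq> U"
    using compact_subset_open_imp_ball_epsilon_subset[OF compact_segment \<open>open U\<close>, of a b] seg
    unfolding U_def by blast
  have tube: "z + t *\<^sub>R h \<in> U" if "z \<in> ball a e" "0 \<le> t" "t \<le> 1" for z t
  proof -
    have "z + t *\<^sub>R h \<in> ball (a + t *\<^sub>R (b - a)) e"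
      using that(1) by (simp add: h_def dist_norm)
    then show ?thesis
      using e closed_segment_plusI[OF that(2,3), of a b] by blast
  qed
  define P where "P x \<longleftrightarrow> ?g differentiable (at x) \<and>
    (\<forall>h. ?D (frechet_derivative ?g (at x) h) \<le> l (?D (?g x)) * N h)" for x
  \<comment> \<open>Passing from the completion to \<open>lborel\<close> gives a Borel null set
    \<open>E\<close> covering all exceptional points.\<close>
  have "AE x in lebesgue. x \<in> X \<longrightarrow> P x"
    using smooth unfolding ell_star_smooth_def P_def by blast
  then have "AE x in lborel. x \<in> X \<longrightarrow> P x"
    by (simp add: AE_completion_iff)
  then obtain E where E: "E \<in> null_sets lborel" "{x. \<not> (x \<in> X \<longrightarrow> P x)} \<subseteq> E"
    by (auto simp: eventually_ae_filter)
  have [measurable]: "E \<in> sets borel"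
    using E(1) by auto
  have good: "?D (?g (z + h) - ?g z) \<le> l M * N h"
    if z: "z \<in> ball a e" and AE: "AE t in lborel. z + t *\<^sub>R h \<notin> E" for z
  proof (rule dual_norm_le[OF N])
    \<comment> \<open>Testing against a fixed \<open>v\<close> reduces the claim to the real
      function \<open>\<phi>\<close> on \<open>{0..1}\<close>.\<close>
    fix v assume v: "N v \<le> 1"
    define \<phi> where "\<phi> t = ?g (z + t *\<^sub>R h) \<bullet> v" for t
    define T where "T = {t::real. z + t *\<^sub>R h \<in> E}"
    have "T \<in> sets lborel"
      unfolding T_def by measurable
    then have "T \<in> null_sets lborel"
      using AE by (simp add: AE_iff_null_sets T_def)
    then have "negligible T"
      by (simp add: negligible_iff_null_sets null_sets_completionI)
    have "\<phi> 1 - \<phi> 0 \<le> (l M * N h) * (1 - 0)"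
    proof (rule increment_le_of_deriv_le_off_negligible[OF _ \<open>negligible T\<close>])
      fix t :: real assume t: "t \<in> {0..1}"
      have "z + t *\<^sub>R h \<in> X"
        using tube[OF z, of t] t by (auto simp: U_def)
      then obtain r K where "r > 0" and K: "K-lipschitz_on (ball (z + t *\<^sub>R h) r \<inter> X) ?g"
        using smooth unfolding ell_star_smooth_def by blast
      \<comment> \<open>The summand 1 in \<open>norm h + 1\<close> covers
        \<open>h = 0\<close>.\<close>
      have "\<bar>\<phi> s - \<phi> t\<bar> \<le> (K * norm h * norm v) * \<bar>s - t\<bar>"
        if s: "s \<in> {0..1}" and st: "\<bar>s - t\<bar> < r / (norm h + 1)" for s
      proof -
        have dist: "dist (z + s *\<^sub>R h) (z + t *\<^sub>R h) = \<bar>s - t\<bar> * norm h"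
          by (simp add: dist_norm flip: scaleR_left_diff_distrib)
        also have "\<dots> \<le> \<bar>s - t\<bar> * (norm h + 1)"
          by (simp add: mult_left_mono)
        also have "\<dots> < r"
          using st by (simp add: pos_less_divide_eq add_nonneg_pos)
        finally have "dist (?g (z + s *\<^sub>R h)) (?g (z + t *\<^sub>R h)) \<le> K * dist (z + s *\<^sub>R h) (z + t *\<^sub>R h)"
          using tube[OF z, of s] s \<open>z + t *\<^sub>R h \<in> X\<close> \<open>r > 0\<close>
          by (intro lipschitz_onD[OF K]) (auto simp: U_def dist_commute)
        then have "norm (?g (z + s *\<^sub>R h) - ?g (z + t *\<^sub>R h)) \<le> K * (\<bar>s - t\<bar> * norm h)"
          by (simp add: dist flip: dist_norm)
        then have "norm (?g (z + s *\<^sub>R h) - ?g (z + t *\<^sub>R h)) * norm v \<le> K * (\<bar>s - t\<bar> * norm h) * norm v"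
          by (intro mult_right_mono) auto
        moreover have "\<bar>\<phi> s - \<phi> t\<bar> \<le> norm (?g (z + s *\<^sub>R h) - ?g (z + t *\<^sub>R h)) * norm v"
          unfolding \<phi>_def inner_diff_left[symmetric] by (rule Cauchy_Schwarz_ineq2)
        ultimately show ?thesis
          by (simp add: algebra_simps)
      qed
      moreover have "r / (norm h + 1) > 0"
        using \<open>r > 0\<close> by (simp add: add_nonneg_pos)
      ultimately show "\<exists>r>0. \<exists>K. \<forall>s\<in>{0..1}. \<bar>s - t\<bar> < r \<longrightarrow> \<bar>\<phi> s - \<phi> t\<bar> \<le> K * \<bar>s - t\<bar>"
        by blast
    next
      fix t assume t: "t \<in> {0<..<1} - T"
      let ?x = "z + t *\<^sub>R h"
      have "?x \<in> U"
        using t by (intro tube[OF z]) auto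
      then have "P ?x" "?D (?g ?x) < M"
        using E(2) t by (auto simp: U_def T_def)
      let ?F = "frechet_derivative ?g (at ?x)"
      have "(?g has_derivative ?F) (at ?x)"
        using \<open>P ?x\<close> frechet_derivative_works P_def by blast
      moreover have "((\<lambda>s. z + s *\<^sub>R h) has_derivative (\<lambda>s. s *\<^sub>R h)) (at t)"
        by (auto intro!: derivative_eq_intros)
      ultimately have "((\<lambda>s. ?g (z + s *\<^sub>R h)) has_derivative (\<lambda>s. ?F (s *\<^sub>R h))) (at t)"
        by (rule has_derivative_compose[rotated])
      then have "(\<phi> has_derivative (\<lambda>s. ?F (s *\<^sub>R h) \<bullet> v)) (at t)"
        unfolding \<phi>_def by (rule has_derivative_inner_left)
      moreover have "linear ?F"
        using \<open>(?g has_derivative ?F) (at ?x)\<close> has_derivative_linear by blast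
      ultimately have "(\<phi> has_real_derivative ?F h \<bullet> v) (at t)"
        by (simp add: has_field_derivative_def linear_scale mult_commute_abs)
      moreover have "?F h \<bullet> v \<le> l M * N h"
      proof -
        have "?F h \<bullet> v \<le> ?D (?F h) * N v"
          by (rule inner_le_dual_norm[OF N])
        also have "\<dots> \<le> ?D (?F h)"
          using v is_norm_simps(1)[OF D] is_norm_simps(1)[OF N] by (simp add: mult_left_le)
        also have "\<dots> \<le> l (?D (?g ?x)) * N h"
          using \<open>P ?x\<close> P_def by blast
        also have "\<dots> \<le> l M * N h"
        proof (rule mult_right_mono)
          have "mono_on {0..} l"
            using l by (simp add: link_function_def)
          then show "l (?D (?g ?x)) \<le> l M"
            using \<open>?D (?g ?x) < M\<close> is_norm_simps(1)[OF D, of "?g ?x"]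
            by (intro mono_onD[of "{0..}" l]) auto
        qed (rule is_norm_simps(1)[OF N])
        finally show ?thesis .
      qed
      ultimately show "\<exists>D\<le>l M * N h. (\<phi> has_real_derivative D) (at t)"
        by blast
    qed simp
    then show "(?g (z + h) - ?g z) \<bullet> v \<le> l M * N h"
      by (simp add: \<phi>_def inner_diff_left)
  qed
  \<comment> \<open>By continuity a failure at \<open>a\<close> spreads to the open set
    \<open>V\<close>, which contains a translate to which \<open>good\<close> applies.\<close>
  define V where "V = {z \<in> ball a e. l M * N h < ?D (?g (z + h) - ?g z)}"
  have "continuous_on (ball a e) (\<lambda>z. ?g (z + h) - ?g z)"
    using tube[where t = 0] tube[where t = 1]
    by (intro continuous_intros continuous_on_compose2[OF cont]) (auto simp: U_def)
  then have "continuous_on (ball a e) (\<lambda>z. ?D (?g (z + h) - ?g z))"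
    by (rule continuous_on_compose2[OF is_norm_continuous_on[OF D, of UNIV]]) simp
  then have "open (ball a e \<inter> (\<lambda>z. ?D (?g (z + h) - ?g z)) -` {l M * N h<..})"
    by (rule continuous_open_preimage[OF _ open_ball open_greaterThan])
  moreover have "V = ball a e \<inter> (\<lambda>z. ?D (?g (z + h) - ?g z)) -` {l M * N h<..}"
    by (auto simp: V_def)
  ultimately have "open V"
    by simp
  moreover have "a \<in> V"
    using contra \<open>e > 0\<close> by (simp add: V_def h_def)
  ultimately obtain z where "z \<in> V" "AE t in lborel. z + t *\<^sub>R h \<notin> E"
    using AE_lborel_ex_in_open[OF AE_line_avoids_null_set[OF E(1)]] by blast
  then show False
    using good[of z] by (auto simp: V_def)
qed

text \<open>Along the segment the gradient stays below \<open>2 * G\<close>: as long as it does, its increment is at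
  most \<open>l (2 * G) * N (b - a) \<le> G\<close>.\<close>

lemma grad_increment_le_near:
  fixes N :: "'a::euclidean_space \<Rightarrow> real"
  assumes N: "is_norm N" and "open X" and l: "link_function l" and smooth: "ell_star_smooth N l X f"
    and seg: "closed_segment a b \<subseteq> X"
    and G: "dual_norm N (grad f a) \<le> G" and near: "l (2 * G) * N (b - a) \<le> G"
  shows "dual_norm N (grad f b - grad f a) \<le> l (2 * G) * N (b - a)"
proof -
  let ?g = "grad f" and ?D = "dual_norm N" and ?p = "\<lambda>t. a + t *\<^sub>R (b - a)"
  note D = is_norm_dual_norm[OF N]
  have "0 \<le> G"
    using G is_norm_simps(1)[OF D] order_trans by blast
  then have "0 < l (2 * G)"
    using l by (simp add: link_function_def)
  show ?thesis
  \<comment> \<open>For \<open>G = 0\<close> no gradient norm is strictly below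
    \<open>2 * G\<close>, but then \<open>near\<close> forces \<open>b = a\<close>.\<close>
  proof (cases "G = 0")
    case True
    then have "N (b - a) \<le> 0"
      using near \<open>0 < l (2 * G)\<close> by (simp add: mult_le_0_iff)
    then have "b = a"
      using is_norm_simps(1,2)[OF N, of "b - a"] by simp
    then show ?thesis
      by (simp add: is_norm_simps[OF N] is_norm_simps[OF D])
  next
    case False
    then have "0 < G"
      using \<open>0 \<le> G\<close> by simp
    have contp: "continuous_on {0..1} (\<lambda>t. ?g (?p t))"
      using closed_segment_plusI[of _ a b] seg
      by (intro continuous_intros continuous_on_compose2[OF ell_star_smooth_continuous_on_grad[OF \<open>open X\<close> smooth]]) auto
    have contD: "continuous_on S (\<lambda>t. ?D (q t))" if "continuous_on S q" for S and q :: "real \<Rightarrow> 'a"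
      by (rule continuous_on_compose2[OF is_norm_continuous_on[OF D, of UNIV] that]) simp
    have bound: "?D (?g (?p s) - ?g a) \<le> l (2 * G) * (s * N (b - a))"
      if s: "0 \<le> s" "s \<le> 1" and below: "\<And>u. 0 \<le> u \<Longrightarrow> u \<le> s \<Longrightarrow> ?D (?g (?p u)) < 2 * G" for s
    proof -
      have "closed_segment a (?p s) \<subseteq> {x \<in> X. ?D (?g x) < 2 * G}"
        using closed_segment_plusI[of _ a b] seg s below by (intro closed_segment_plus_subset) auto
      from grad_increment_le[OF N \<open>open X\<close> l smooth this] show ?thesis
        using s by (simp add: is_norm_simps(4)[OF N])
    qed
    define T where "T = {t \<in> {0..1}. 2 * G \<le> ?D (?g (?p t))}"
    show ?thesis
    proof (cases "T = {}")
      case True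
      then have "?D (?g (?p u)) < 2 * G" if "0 \<le> u" "u \<le> 1" for u
        using that by (force simp: T_def)
      then show ?thesis
        using bound[of 1] by simp
    next
      case False
      have "compact T"
        unfolding T_def compact_eq_bounded_closed
        by (intro conjI continuous_on_closed_Collect_le contD contp continuous_on_const closed_atLeastAtMost
            bounded_subset[OF bounded_closed_interval[of 0 "1::real"]] Collect_restrict)
      then obtain t where t: "t \<in> T" and min: "\<And>s. s \<in> T \<Longrightarrow> t \<le> s"
        using compact_attains_inf[OF _ False] by blast
      have t01: "0 \<le> t" "t \<le> 1"
        using t by (auto simp: T_def)
      have "0 \<notin> T"
        using G \<open>0 < G\<close> by (simp add: T_def)
      then have "0 < t"
        using t t01 by (cases "t = 0") auto
      \<comment> \<open>\<open>bound\<close> applies only before the first time \<open>t\<close> at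
        which the level \<open>2 * G\<close> is reached; continuity of \<open>F\<close> carries the
        estimate to \<open>t\<close> itself.\<close>
      define F where "F s = l (2 * G) * (s * N (b - a)) - ?D (?g (?p s) - ?g a)" for s
      have "continuous_on {0..1} F"
        unfolding F_def by (intro continuous_intros contD contp)
      then have "continuous_on (closure {0..<t}) F"
        using \<open>0 < t\<close> t01 by (auto intro: continuous_on_subset)
      moreover have "t \<in> closure {0..<t}"
        using \<open>0 < t\<close> by simp
      moreover have "0 \<le> F s" if s: "s \<in> {0..<t}" for s
      proof -
        have "?D (?g (?p u)) < 2 * G" if "0 \<le> u" "u \<le> s" for u
          using min[of u] that s t01 by (force simp: T_def)
        then show ?thesis
          unfolding F_def using bound[of s] s t01 by auto
      qed
      ultimately have "0 \<le> F t"
        by (rule continuous_ge_on_closure)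
      then have le: "?D (?g (?p t) - ?g a) \<le> t * (l (2 * G) * N (b - a))"
        by (simp add: F_def algebra_simps)
      also have "\<dots> \<le> t * G"
        using near t01 by (intro mult_left_mono) auto
      finally have "?D (?g (?p t)) \<le> t * G + G"
        using is_norm_triangle[OF D, of "?g (?p t)" 0 "?g a"] G by simp
      \<comment> \<open>So the level can be reached only at the endpoint, where \<open>le\<close> is
        already the claim.\<close>
      then have "2 * G \<le> t * G + G"
        using t by (simp add: T_def)
      then have "t = 1"
        using \<open>0 < G\<close> t01 by simp
      then show ?thesis
        using le by simp
    qed
  qed
qed

text \<open>Compare \<open>f a\<close> with the value of \<open>f\<close> after a step of length \<open>G / l (2 * G)\<close> in the direction of
  steepest descent. The step stays in \<open>X\<close> because \<open>f\<close> decreases along it and its sublevel sets are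
  closed.\<close>

lemma dual_norm_grad_sq_le:
  fixes N :: "'a::euclidean_space \<Rightarrow> real"
  assumes N: "is_norm N" and "open X" and l: "link_function l" and smooth: "ell_star_smooth N l X f"
    and closed: "closed_function X f"
    and a: "a \<in> X" and lower: "\<And>z. z \<in> X \<Longrightarrow> m \<le> f z"
  shows "(dual_norm N (grad f a))\<^sup>2 \<le> 2 * l (2 * dual_norm N (grad f a)) * (f a - m)"
proof -
  let ?g = "grad f" and ?D = "dual_norm N"
  define G where "G = ?D (?g a)"
  define L where "L = l (2 * G)"
  note D = is_norm_dual_norm[OF N]
  have "0 \<le> G"
    unfolding G_def by (rule is_norm_simps(1)[OF D])
  then have "0 < L"
    using l by (simp add: link_function_def L_def)
  obtain v where v: "N v \<le> 1" "G = ?g a \<bullet> v"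
    using dual_norm_attained[OF N, of "?g a"] unfolding G_def by blast
  have descent: "f (a + s *\<^sub>R (- v)) \<le> f a - s * G + L * s\<^sup>2 / 2"
    if s: "0 \<le> s" "L * s \<le> G" and inX: "\<And>u. 0 \<le> u \<Longrightarrow> u \<le> s \<Longrightarrow> a + u *\<^sub>R (- v) \<in> X" for s
  proof -
    \<comment> \<open>Since \<open>G = ?g a \<bullet> v\<close>, the derivative of
      \<open>\<phi>\<close> is \<open>(?g ?x - ?g a) \<bullet> (- v) - L * u\<close>, which the
      local Lipschitz bound makes nonpositive.\<close>
    define \<phi> where "\<phi> u = f (a + u *\<^sub>R (- v)) + u * G - L * u\<^sup>2 / 2" for u
    have "\<phi> 0 \<ge> \<phi> s"
    proof (rule DERIV_nonpos_imp_nonincreasing[OF s(1)])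
      fix u assume u: "0 \<le> u" "u \<le> s"
      let ?x = "a + u *\<^sub>R (- v)"
      have "f differentiable (at ?x)"
        using smooth inX[OF u] by (simp add: ell_star_smooth_def)
      from DERIV_line_grad[OF this]
      have "(\<phi> has_real_derivative ?g ?x \<bullet> (- v) + G - L * u) (at u)"
        unfolding \<phi>_def by (auto intro!: derivative_eq_intros)
      moreover have "?g ?x \<bullet> (- v) + G - L * u \<le> 0"
      proof -
        have seg: "closed_segment a ?x \<subseteq> X"
          using u inX by (intro closed_segment_plus_subset) auto
        have Nx: "N (?x - a) \<le> u"
          using u v(1) is_norm_simps(4)[OF N, of "- u" v] by (simp add: mult_left_le)
        have "L * N (?x - a) \<le> L * u"
          using Nx \<open>0 < L\<close> by simp
        also have "\<dots> \<le> L * s"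
          using u \<open>0 < L\<close> by simp
        finally have "L * N (?x - a) \<le> G"
          using s(2) by simp
        then have "?D (?g ?x - ?g a) \<le> L * N (?x - a)"
          unfolding L_def
          by (intro grad_increment_le_near[OF N \<open>open X\<close> l smooth seg]) (auto simp: G_def)
        then have "?D (?g ?x - ?g a) \<le> L * u"
          using \<open>L * N (?x - a) \<le> L * u\<close> by simp
        moreover have "(?g ?x - ?g a) \<bullet> (- v) \<le> ?D (?g ?x - ?g a)"
          using inner_le_dual_norm[OF N, of "?g ?x - ?g a" "- v"] v(1) is_norm_simps(1)[OF D, of "?g ?x - ?g a"]
          by (simp add: is_norm_simps(6)[OF N]) (meson mult_left_le order_trans)
        ultimately show ?thesis
          by (simp add: v(2) inner_diff_left)
      qed
      ultimately show "\<exists>y. (\<phi> has_real_derivative y) (at u) \<and> y \<le> 0"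
        by blast
    qed
    then show ?thesis
      by (simp add: \<phi>_def)
  qed
  \<comment> \<open>This length minimises the quadratic bound in \<open>descent\<close> and is the
    largest one with \<open>L * s \<le> G\<close>.\<close>
  define r where "r = G / L"
  have r: "0 \<le> r" "L * r = G"
    using \<open>0 \<le> G\<close> \<open>0 < L\<close> by (auto simp: r_def)
  \<comment> \<open>Openness of \<open>X\<close> makes \<open>Q\<close> compact, so leaving
    \<open>X\<close> would happen at a first parameter, a limit of points of the sublevel set of
    \<open>f a\<close>.\<close>
  define Q where "Q = {0..r} \<inter> (\<lambda>s. a + s *\<^sub>R (- v)) -` (- X)"
  have "Q = {}"
  proof (rule ccontr)
    assume "Q \<noteq> {}"
    have "closed ((\<lambda>s. a + s *\<^sub>R (- v)) -` (- X))"
      using \<open>open X\<close> by (intro continuous_closed_vimage continuous_intros) auto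
    then have "compact Q"
      unfolding Q_def by (intro compact_Int_closed) auto
    then obtain s where "s \<in> Q" and min: "\<And>u. u \<in> Q \<Longrightarrow> s \<le> u"
      using compact_attains_inf[of Q] \<open>Q \<noteq> {}\<close> by blast
    then have s: "0 \<le> s" "s \<le> r" "a + s *\<^sub>R (- v) \<notin> X"
      by (auto simp: Q_def)
    have "s \<noteq> 0"
      using s(3) a by (cases "s = 0") auto
    then have "0 < s"
      using s(1) by simp
    define C where "C = {z \<in> X. f z \<le> f a}"
    have "a + u *\<^sub>R (- v) \<in> C" if u: "u \<in> {0..<s}" for u
    proof -
      have inX: "a + w *\<^sub>R (- v) \<in> X" if "0 \<le> w" "w \<le> u" for w
        using min[of w] that u s by (force simp: Q_def)
      have "L * u \<le> L * r"
        using u s \<open>0 < L\<close> by (intro mult_left_mono) auto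
      then have "L * u \<le> G"
        using r by simp
      have "u * (L * u) \<le> u * G"
        using u \<open>L * u \<le> G\<close> by (intro mult_left_mono) auto
      moreover have "0 \<le> u * G"
        using u \<open>0 \<le> G\<close> by simp
      ultimately have "f (a + u *\<^sub>R (- v)) \<le> f a"
        using descent[of u] inX u \<open>L * u \<le> G\<close> by (simp add: power2_eq_square mult_ac)
      then show ?thesis
        using inX[of u] u by (simp add: C_def)
    qed
    then have "{0..<s} \<subseteq> (\<lambda>s. a + s *\<^sub>R (- v)) -` C"
      by blast
    moreover have "closed C"
      using closed by (simp add: closed_function_def C_def)
    then have "closed ((\<lambda>s. a + s *\<^sub>R (- v)) -` C)"
      by (intro continuous_closed_vimage continuous_intros) auto
    ultimately have "closure {0..<s} \<subseteq> (\<lambda>s. a + s *\<^sub>R (- v)) -` C"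
      by (rule closure_minimal)
    then show False
      using \<open>0 < s\<close> s(3) by (auto simp: C_def subset_iff)
  qed
  then have inX: "a + u *\<^sub>R (- v) \<in> X" if "0 \<le> u" "u \<le> r" for u
    using that by (auto simp: Q_def)
  have "m \<le> f (a + r *\<^sub>R (- v))"
    using r(1) by (intro lower inX) auto
  also have "\<dots> \<le> f a - r * G + L * r\<^sup>2 / 2"
    using r inX by (intro descent) auto
  also have "\<dots> = f a - G\<^sup>2 / (2 * L)"
    using \<open>0 < L\<close> by (simp add: r_def power2_eq_square field_simps)
  finally show ?thesis
    using \<open>0 < L\<close> unfolding G_def[symmetric] L_def[symmetric] by (simp add: field_simps)
qed

text \<open>Were the tangent at \<open>a\<close> steeper than the chord, \<open>f\<close> would rise
  above the chord just after \<open>a\<close>.\<close>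

lemma convex_on_grad_le:
  fixes f :: "'a::euclidean_space \<Rightarrow> real"
  assumes conv: "convex_on X f" and "f differentiable (at a)" "a \<in> X" "b \<in> X"
  shows "f b - f a \<ge> grad f a \<bullet> (b - a)"
proof (rule ccontr)
  assume contra: "\<not> ?thesis"
  define \<theta> where "\<theta> s = f (a + s *\<^sub>R (b - a)) - s * (f b - f a)" for s
  have "f differentiable (at (a + 0 *\<^sub>R (b - a)))"
    using assms(2) by simp
  from DERIV_line_grad[OF this]
  have "(\<theta> has_real_derivative grad f a \<bullet> (b - a) - (f b - f a)) (at 0)"
    unfolding \<theta>_def by (auto intro!: derivative_eq_intros)
  moreover have "grad f a \<bullet> (b - a) - (f b - f a) > 0"
    using contra by simp
  ultimately obtain d where d: "d > 0" "\<And>s. 0 < s \<Longrightarrow> s < d \<Longrightarrow> \<theta> 0 < \<theta> (0 + s)"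
    using DERIV_pos_inc_right by blast
  define s where "s = min (d / 2) 1"
  have s: "0 < s" "s < d" "s \<le> 1"
    using d(1) by (auto simp: s_def)
  have "f ((1 - s) *\<^sub>R a + s *\<^sub>R b) \<le> (1 - s) * f a + s * f b"
    using s assms by (intro convex_onD[OF conv]) auto
  moreover have "(1 - s) *\<^sub>R a + s *\<^sub>R b = a + s *\<^sub>R (b - a)"
    by (simp add: algebra_simps)
  ultimately show False
    using d(2)[OF s(1,2)] by (simp add: \<theta>_def algebra_simps)
qed

section \<open>Mirror maps and prox-mappings\<close>

text \<open>Subtracting the linear function of \<open>p\<close> leaves a local minimum at the
  interior point \<open>a\<close>. Its derivative in the direction \<open>grad \<psi> a - p\<close>
  is the squared length of that vector.\<close>

lemma grad_eq_subgradient: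
  fixes \<psi> :: "'a::euclidean_space \<Rightarrow> real"
  assumes "open X" "a \<in> X" "\<psi> differentiable (at a)" and p: "p \<in> subdifferential X \<psi> a"
  shows "grad \<psi> a = p"
proof -
  define h where "h = grad \<psi> a - p"
  define \<theta> where "\<theta> s = \<psi> (a + s *\<^sub>R h) - s * (p \<bullet> h)" for s
  have "\<psi> differentiable (at (a + 0 *\<^sub>R h))"
    using assms(3) by simp
  from DERIV_line_grad[OF this]
  have deriv: "(\<theta> has_real_derivative grad \<psi> a \<bullet> h - p \<bullet> h) (at 0)"
    unfolding \<theta>_def by (auto intro!: derivative_eq_intros)
  obtain e where e: "e > 0" "ball a e \<subseteq> X"
    using assms(1,2) open_contains_ball by blast
  have "\<theta> 0 \<le> \<theta> s" if "\<bar>0 - s\<bar> < e / (norm h + 1)" for s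
  proof -
    have "norm (s *\<^sub>R h) \<le> \<bar>s\<bar> * (norm h + 1)"
      by (simp add: mult_left_mono)
    also have "\<dots> < e"
      using that by (simp add: pos_less_divide_eq add_nonneg_pos)
    finally have "a + s *\<^sub>R h \<in> X"
      using e(2) by (auto simp: dist_norm)
    then have "\<psi> a + p \<bullet> (s *\<^sub>R h) \<le> \<psi> (a + s *\<^sub>R h)"
      using p by (force simp: subdifferential_def)
    then show ?thesis
      by (simp add: \<theta>_def)
  qed
  moreover have "0 < e / (norm h + 1)"
    using e(1) by (simp add: add_nonneg_pos)
  ultimately have "grad \<psi> a \<bullet> h - p \<bullet> h = 0"
    using DERIV_local_min[OF deriv] by blast
  then have "h \<bullet> h = 0"
    by (simp add: h_def inner_diff_left)
  then show ?thesis
    by (simp add: h_def)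
qed

lemma grad_in_subdifferential:
  fixes \<psi> :: "'a::euclidean_space \<Rightarrow> real"
  assumes "open X" "mirror_map N X \<psi>" "a \<in> subdiff_domain X \<psi>"
  shows "grad \<psi> a \<in> subdifferential X \<psi> a"
proof -
  have "\<psi> differentiable (at a)" "a \<in> X"
    using assms(2,3) by (auto simp: mirror_map_def subdiff_domain_def)
  moreover obtain p where "p \<in> subdifferential X \<psi> a"
    using assms(3) by (auto simp: subdiff_domain_def)
  ultimately show ?thesis
    using grad_eq_subgradient[OF assms(1)] by metis
qed

text \<open>Minimality of \<open>z\<close> says precisely that \<open>grad \<psi> y - g\<close> is a
  subgradient of \<open>\<psi>\<close> at \<open>z\<close>, and at an interior point this must be
  the gradient.\<close>

lemma prox_grad:
  fixes \<psi> :: "'a::euclidean_space \<Rightarrow> real"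
  assumes "open X" "mirror_map N X \<psi>" and z: "z \<in> prox X \<psi> y g"
  shows "z \<in> subdiff_domain X \<psi>" "grad \<psi> z = grad \<psi> y - g"
proof -
  have "z \<in> X" and "\<And>w. w \<in> X \<Longrightarrow> g \<bullet> z + bregman \<psi> z y \<le> g \<bullet> w + bregman \<psi> w y"
    using z by (auto simp: prox_def is_arg_min_linorder)
  then have sub: "grad \<psi> y - g \<in> subdifferential X \<psi> z"
    by (fastforce simp: subdifferential_def bregman_def inner_diff_left inner_diff_right)
  then show "z \<in> subdiff_domain X \<psi>"
    using \<open>z \<in> X\<close> by (auto simp: subdiff_domain_def)
  then show "grad \<psi> z = grad \<psi> y - g"
    using assms(2) by (intro grad_eq_subgradient[OF assms(1) \<open>z \<in> X\<close> _ sub]) (auto simp: mirror_map_def)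
qed

text \<open>Here \<open>x\<close> ranges over all of \<open>X\<close>, as required for the
  comparison point \<open>xstar\<close>, which need not lie in
  \<open>subdiff_domain X \<psi>\<close>.\<close>

lemma bregman_nonneg:
  fixes \<psi> :: "'a::euclidean_space \<Rightarrow> real"
  assumes "open X" "mirror_map N X \<psi>" "z \<in> subdiff_domain X \<psi>" "x \<in> X"
  shows "0 \<le> bregman \<psi> x z"
  using grad_in_subdifferential[OF assms(1,2,3)] assms(4)
  by (force simp: subdifferential_def bregman_def)

text \<open>Strong monotonicity makes \<open>grad \<psi>\<close> expanding, so a gradient update
  bounds the distance that the iterate moves.\<close>

lemma norm_le_dual_norm_grad_mirror:
  fixes N :: "'a::euclidean_space \<Rightarrow> real"
  assumes "is_norm N" "mirror_map N X \<psi>" "x \<in> subdiff_domain X \<psi>" "z \<in> subdiff_domain X \<psi>"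
  shows "N (x - z) \<le> dual_norm N (grad \<psi> x - grad \<psi> z)"
proof (cases "N (x - z) = 0")
  case False
  have "(N (x - z))\<^sup>2 \<le> (grad \<psi> x - grad \<psi> z) \<bullet> (x - z)"
    using assms(2-4) by (simp add: mirror_map_def)
  also have "\<dots> \<le> dual_norm N (grad \<psi> x - grad \<psi> z) * N (x - z)"
    by (rule inner_le_dual_norm[OF assms(1)])
  finally show ?thesis
    using False is_norm_simps(1)[OF assms(1), of "x - z"] by (simp add: power2_eq_square)
qed (simp add: is_norm_simps(1)[OF is_norm_dual_norm[OF assms(1)]])

text \<open>Strong monotonicity is integrated along the segment, which stays in
  \<open>subdiff_domain X \<psi>\<close> by convexity of that set.\<close>

lemma bregman_ge_norm_sq:
  fixes N :: "'a::euclidean_space \<Rightarrow> real"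
  assumes N: "is_norm N" and mirror: "mirror_map N X \<psi>"
    and x: "x \<in> subdiff_domain X \<psi>" and z: "z \<in> subdiff_domain X \<psi>"
  shows "(N (x - z))\<^sup>2 / 2 \<le> bregman \<psi> x z"
proof -
  let ?p = "\<lambda>s. z + s *\<^sub>R (x - z)"
  define \<phi> where "\<phi> s = \<psi> (?p s) - s * (grad \<psi> z \<bullet> (x - z)) - s\<^sup>2 * (N (x - z))\<^sup>2 / 2" for s
  have "\<phi> 0 \<le> \<phi> 1"
  proof (rule DERIV_nonneg_imp_nondecreasing[where f = \<phi>])
    fix s :: real assume s: "0 \<le> s" "s \<le> 1"
    have ps: "?p s \<in> subdiff_domain X \<psi>"
      using closed_segment_plusI[OF s, of z x] x z mirror closed_segment_subset
      unfolding mirror_map_def by blast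
    then have "\<psi> differentiable (at (?p s))"
      using mirror by (simp add: mirror_map_def)
    from DERIV_line_grad[OF this]
    have "(\<phi> has_real_derivative grad \<psi> (?p s) \<bullet> (x - z) - grad \<psi> z \<bullet> (x - z) - s * (N (x - z))\<^sup>2) (at s)"
      unfolding \<phi>_def by (auto intro!: derivative_eq_intros)
    moreover have "0 \<le> grad \<psi> (?p s) \<bullet> (x - z) - grad \<psi> z \<bullet> (x - z) - s * (N (x - z))\<^sup>2"
    proof (cases "s = 0")
      case False
      have "(N (?p s - z))\<^sup>2 \<le> (grad \<psi> (?p s) - grad \<psi> z) \<bullet> (?p s - z)"
        using mirror ps z unfolding mirror_map_def by blast
      then have "s * (s * (N (x - z))\<^sup>2) \<le> s * ((grad \<psi> (?p s) - grad \<psi> z) \<bullet> (x - z))"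
        using s by (simp add: is_norm_simps(4)[OF N] power2_eq_square mult_ac)
      then show ?thesis
        using False s by (simp add: inner_diff_left)
    qed simp
    ultimately show "\<exists>y. (\<phi> has_real_derivative y) (at s) \<and> 0 \<le> y"
      by blast
  qed simp
  then show ?thesis
    by (simp add: \<phi>_def bregman_def)
qed

section \<open>Optimistic mirror descent\<close>

text \<open>Writing \<open>d\<close> for the distance of the two current iterates, \<open>f x + L * d\<^sup>2\<close> serves as a Lyapunov
  function: it keeps the iterates in a sublevel set on which the gradient is bounded by \<open>G\<close>.
  The bound \<open>3 * L * d \<le> 2 * G\<close> keeps the next step in the range of local smoothness.\<close>

lemma optimistic_mirror_descent_step:
  fixes N :: "'a::euclidean_space \<Rightarrow> real"
  assumes N: "is_norm N" and "open X" "convex X" and conv: "convex_on X f"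
    and l: "link_function l" and smooth: "ell_star_smooth N l X f" and mirror: "mirror_map N X \<psi>"
    and L: "L = l (2 * G)" and \<eta>: "0 < \<eta>" "3 * L * \<eta> \<le> 1"
    and sublevel: "\<forall>z\<in>X. f z \<le> c \<longrightarrow> dual_norm N (grad f z) \<le> G"
    and x: "x \<in> subdiff_domain X \<psi>" and y: "y \<in> subdiff_domain X \<psi>"
    and Gy: "dual_norm N (grad f y) \<le> G" and near: "3 * L * N (x - y) \<le> 2 * G"
    and lyapunov: "f x + L * (N (x - y))\<^sup>2 \<le> c"
    and y': "y' \<in> prox X \<psi> x (\<eta> *\<^sub>R grad f y)" and x': "x' \<in> prox X \<psi> x (\<eta> *\<^sub>R grad f y')"
  shows "x' \<in> subdiff_domain X \<psi>" "y' \<in> subdiff_domain X \<psi>"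
    "dual_norm N (grad f y') \<le> G" "3 * L * N (x' - y') \<le> 2 * G"
    "f x' + L * (N (x' - y'))\<^sup>2 \<le> c"
    "u \<in> X \<Longrightarrow> \<eta> * (f y' - f u) \<le>
      (bregman \<psi> u x - bregman \<psi> u x') + ((N (x - y))\<^sup>2 / 6 - (N (x' - y'))\<^sup>2 / 6)"
proof -
  let ?D = "dual_norm N" and ?g = "grad f" and ?gp = "grad \<psi>"
  define p d s e where "p = N (y' - x)" "d = N (x' - y')" "s = N (x' - x)" "e = N (x - y)"
  note pdse = p_d_s_e_def
  note D = is_norm_dual_norm[OF N]
  have nonneg: "0 \<le> p" "0 \<le> d" "0 \<le> s" "0 \<le> e"
    by (simp_all add: pdse is_norm_simps(1)[OF N])
  have "0 \<le> G"
    using Gy is_norm_simps(1)[OF D] order_trans by blast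
  then have "0 < L"
    using l L by (simp add: link_function_def)
  note prox_y' = prox_grad[OF \<open>open X\<close> mirror y']
  note prox_x' = prox_grad[OF \<open>open X\<close> mirror x']
  show dom: "x' \<in> subdiff_domain X \<psi>" "y' \<in> subdiff_domain X \<psi>"
    by (fact prox_x'(1), fact prox_y'(1))
  have inX: "x \<in> X" "y \<in> X" "x' \<in> X" "y' \<in> X"
    using x y dom by (auto simp: subdiff_domain_def)
  have diff: "f differentiable (at z)" if "z \<in> X" for z
    using smooth that by (simp add: ell_star_smooth_def)
  have seg: "closed_segment a b \<subseteq> X" if "a \<in> X" "b \<in> X" for a b
    using \<open>convex X\<close> that by (rule closed_segment_subset[rotated 2])
  \<comment> \<open>The step-size condition enters the distance and descent bounds in this
    form.\<close>
  have \<eta>_scale: "3 * L * t \<le> b" if "t \<le> \<eta> * b" "0 \<le> b" for t b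
  proof -
    have "3 * L * t \<le> 3 * L * (\<eta> * b)"
      using that(1) \<open>0 < L\<close> by simp
    also have "\<dots> = (3 * L * \<eta>) * b"
      by simp
    also have "\<dots> \<le> 1 * b"
      using \<eta>(2) that(2) by (rule mult_right_mono)
    finally show ?thesis
      by simp
  qed

  have inner_step: "g \<bullet> (z - x) \<le> - 3 * L * (N (z - x))\<^sup>2"
    if z: "z \<in> subdiff_domain X \<psi>" and gz: "?gp z = ?gp x - \<eta> *\<^sub>R g" for z g
  proof -
    have "(N (z - x))\<^sup>2 \<le> (?gp z - ?gp x) \<bullet> (z - x)"
      using mirror z x by (simp add: mirror_map_def)
    also have "\<dots> = \<eta> * - (g \<bullet> (z - x))"
      by (simp add: gz)
    finally have le: "(N (z - x))\<^sup>2 \<le> \<eta> * - (g \<bullet> (z - x))" .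
    then have "0 \<le> \<eta> * - (g \<bullet> (z - x))"
      using zero_le_power2 order_trans by blast
    then have "0 \<le> - (g \<bullet> (z - x))"
      using \<eta>(1) by (simp only: zero_le_mult_iff) auto
    from \<eta>_scale[OF le this] show ?thesis
      by simp
  qed

  have "p \<le> ?D (?gp y' - ?gp x)"
    unfolding pdse by (rule norm_le_dual_norm_grad_mirror[OF N mirror dom(2) x])
  also have "\<dots> = \<eta> * ?D (?g y)"
    using \<eta>(1) by (simp add: prox_y'(2) is_norm_simps(4,6)[OF D])
  also have "\<dots> \<le> \<eta> * G"
    using Gy \<eta>(1) by simp
  finally have p_le: "3 * L * p \<le> G"
    using \<eta>_scale \<open>0 \<le> G\<close> by blast
  have yy': "N (y' - y) \<le> p + e"
    unfolding pdse by (rule is_norm_triangle[OF N])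
  \<comment> \<open>\<open>G / 3\<close> from the new step and \<open>2 * G / 3\<close> from
    \<open>near\<close> add up to \<open>G\<close>, exactly the range of
    \<open>grad_increment_le_near\<close>.\<close>
  then have "L * N (y' - y) \<le> L * (p + e)"
    using \<open>0 < L\<close> by simp
  also have "\<dots> \<le> G"
    using p_le near by (simp add: pdse algebra_simps)
  finally have smooth_yy': "?D (?g y' - ?g y) \<le> L * N (y' - y)"
    unfolding L using inX by (intro grad_increment_le_near[OF N \<open>open X\<close> l smooth seg Gy])
  also have "\<dots> \<le> L * (p + e)"
    using yy' \<open>0 < L\<close> by simp
  finally have Dyy': "?D (?g y' - ?g y) \<le> L * (p + e)" .

  \<comment> \<open>Convexity brings in the gradient at \<open>y'\<close>, whereas the prox step
    yields descent for the gradient at \<open>y\<close>; smoothness bounds the difference.\<close>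
  have "f y' - f x \<le> ?g y' \<bullet> (y' - x)"
    using convex_on_grad_le[OF conv diff inX(4,1)] inX(4) by (simp add: inner_diff_right)
  also have "\<dots> = ?g y \<bullet> (y' - x) + (?g y' - ?g y) \<bullet> (y' - x)"
    by (simp add: inner_diff_left)
  also have "\<dots> \<le> - 3 * L * p\<^sup>2 + L * (p + e) * p"
  proof (rule add_mono)
    show "?g y \<bullet> (y' - x) \<le> - 3 * L * p\<^sup>2"
      unfolding pdse using prox_y' by (rule inner_step)
    show "(?g y' - ?g y) \<bullet> (y' - x) \<le> L * (p + e) * p"
      using inner_le_dual_norm[OF N, of "?g y' - ?g y" "y' - x"] mult_right_mono[OF Dyy' nonneg(1)]
      by (simp add: pdse)
  qed
  also have "\<dots> = L * (p * e - 2 * p\<^sup>2)"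
    by (simp add: power2_eq_square algebra_simps)
  also have "\<dots> \<le> L * e\<^sup>2"
  proof -
    have "0 \<le> (p - e)\<^sup>2 + 3 * p\<^sup>2 + e\<^sup>2"
      by simp
    then have "p * e - 2 * p\<^sup>2 \<le> e\<^sup>2"
      by (simp add: power2_eq_square algebra_simps)
    then show ?thesis
      using \<open>0 < L\<close> by simp
  qed
  \<comment> \<open>The error \<open>L * e\<^sup>2\<close> is just what the Lyapunov function holds
    in reserve.\<close>
  finally have "f y' \<le> c"
    using lyapunov by (simp add: pdse)
  then show Gy': "?D (?g y') \<le> G"
    using sublevel inX(4) by blast

  \<comment> \<open>Both prox steps start at \<open>x\<close>, so \<open>grad \<psi> x\<close>
    cancels and only the change of gradient remains.\<close>
  have "d \<le> ?D (?gp x' - ?gp y')"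
    unfolding pdse by (rule norm_le_dual_norm_grad_mirror[OF N mirror dom])
  also have "?gp x' - ?gp y' = - \<eta> *\<^sub>R (?g y' - ?g y)"
    by (simp add: prox_x'(2) prox_y'(2) algebra_simps)
  also have "?D \<dots> = \<eta> * ?D (?g y' - ?g y)"
    using \<eta>(1) by (simp only: is_norm_simps(4)[OF D])
  finally have d_le: "3 * L * d \<le> ?D (?g y' - ?g y)"
    using \<eta>_scale is_norm_simps(1)[OF D] by blast
  have "?D (?g y' - ?g y) \<le> 2 * G"
    using is_norm_simps(5)[OF D, of "?g y'" "- ?g y"] Gy Gy' by (simp add: is_norm_simps(6)[OF D])
  with d_le show near': "3 * L * N (x' - y') \<le> 2 * G"
    by (simp add: pdse)
  have "L * (3 * d) \<le> L * N (y' - y)"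
    using d_le smooth_yy' by simp
  then have "3 * d \<le> N (y' - y)"
    using \<open>0 < L\<close> by simp
  \<comment> \<open>The detour through \<open>x'\<close> bounds \<open>d\<close> by
    \<open>s\<close>, for which the descent estimate below has a negative quadratic term.\<close>
  also have "\<dots> \<le> N (y' - x') + (N (x' - x) + N (x - y))"
    using is_norm_triangle[OF N, of y' y x'] is_norm_triangle[OF N, of x' y x] by simp
  also have "N (y' - x') = d"
    unfolding pdse by (rule is_norm_minus_commute[OF N])
  finally have d2: "2 * d \<le> s + e"
    by (simp add: pdse)

  have "?D (?g x' - ?g y') \<le> L * d"
    unfolding L pdse using inX near' \<open>0 \<le> G\<close> L
    by (intro grad_increment_le_near[OF N \<open>open X\<close> l smooth seg Gy']) auto
  note Dxy' = this
  have "f x' - f x \<le> ?g x' \<bullet> (x' - x)"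
    using convex_on_grad_le[OF conv diff inX(3,1)] inX(3) by (simp add: inner_diff_right)
  also have "\<dots> = ?g y' \<bullet> (x' - x) + (?g x' - ?g y') \<bullet> (x' - x)"
    by (simp add: inner_diff_left)
  also have "\<dots> \<le> - 3 * L * s\<^sup>2 + L * d * s"
  proof (rule add_mono)
    show "?g y' \<bullet> (x' - x) \<le> - 3 * L * s\<^sup>2"
      unfolding pdse using prox_x' by (rule inner_step)
    show "(?g x' - ?g y') \<bullet> (x' - x) \<le> L * d * s"
      using inner_le_dual_norm[OF N, of "?g x' - ?g y'" "x' - x"] mult_right_mono[OF Dxy' nonneg(3)]
      by (simp add: pdse)
  qed
  also have "\<dots> = L * (d * s - 3 * s\<^sup>2)"
    by (simp add: power2_eq_square algebra_simps)
  also have "\<dots> \<le> L * (e\<^sup>2 - d\<^sup>2)"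
  proof -
    have "(2 * d) * s \<le> (s + e) * s"
      using d2 nonneg by (intro mult_right_mono) auto
    moreover have "(2 * d)\<^sup>2 \<le> (s + e)\<^sup>2"
      using d2 nonneg by (intro power_mono) auto
    \<comment> \<open>Four times the goal, after twice the first bound and once the second, reduces
      to \<open>0 \<le> 9 * s\<^sup>2 - 4 * s * e + 3 * e\<^sup>2\<close>, written as
      squares.\<close>
    moreover have "0 \<le> (2 * s - e)\<^sup>2 + 5 * s\<^sup>2 + 2 * e\<^sup>2"
      by simp
    ultimately have "d * s - 3 * s\<^sup>2 \<le> e\<^sup>2 - d\<^sup>2"
      by (simp add: power2_eq_square algebra_simps)
    then show ?thesis
      using \<open>0 < L\<close> by simp
  qed
  finally show "f x' + L * (N (x' - y'))\<^sup>2 \<le> c"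
    using lyapunov by (simp add: pdse algebra_simps)

  show "\<eta> * (f y' - f u) \<le>
      (bregman \<psi> u x - bregman \<psi> u x') + ((N (x - y))\<^sup>2 / 6 - (N (x' - y'))\<^sup>2 / 6)" if "u \<in> X"
  proof -
    have "f y' - f u \<le> ?g y' \<bullet> (y' - u)"
      using convex_on_grad_le[OF conv diff inX(4) that] inX(4) by (simp add: inner_diff_right)
    then have "\<eta> * (f y' - f u) \<le> \<eta> * (?g y' \<bullet> (y' - u))"
      using \<eta>(1) by simp
    \<comment> \<open>Two three-point identities, one for each prox step, in which
      \<open>bregman \<psi> x' x\<close> cancels.\<close>
    also have "\<dots> = bregman \<psi> u x - bregman \<psi> u x' - bregman \<psi> x' y' - bregman \<psi> y' x
        + \<eta> * ((?g y' - ?g y) \<bullet> (y' - x'))"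
      by (simp add: bregman_def prox_x'(2) prox_y'(2) algebra_simps inner_diff_left inner_diff_right)
    also have "\<dots> \<le> bregman \<psi> u x - bregman \<psi> u x' - d\<^sup>2 / 2 - p\<^sup>2 / 2 + (p + e) * d / 3"
    proof -
      have "d\<^sup>2 / 2 \<le> bregman \<psi> x' y'" "p\<^sup>2 / 2 \<le> bregman \<psi> y' x"
        unfolding pdse using bregman_ge_norm_sq[OF N mirror] dom x by blast+
      moreover have "\<eta> * ((?g y' - ?g y) \<bullet> (y' - x')) \<le> (p + e) * d / 3"
      proof -
        have "(?g y' - ?g y) \<bullet> (y' - x') \<le> ?D (?g y' - ?g y) * d"
          unfolding pdse is_norm_minus_commute[OF N, of x' y'] by (rule inner_le_dual_norm[OF N])
        also have "\<dots> \<le> L * (p + e) * d"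
          using Dyy' nonneg(2) by (rule mult_right_mono)
        finally have "\<eta> * ((?g y' - ?g y) \<bullet> (y' - x')) \<le> \<eta> * (L * (p + e) * d)"
          using \<eta>(1) by simp
        also have "\<dots> = (3 * L * \<eta>) * ((p + e) * d / 3)"
          by simp
        also have "\<dots> \<le> 1 * ((p + e) * d / 3)"
          using \<eta>(2) nonneg by (intro mult_right_mono) auto
        finally show ?thesis
          by simp
      qed
      ultimately show ?thesis
        by simp
    qed
    also have "\<dots> \<le> (bregman \<psi> u x - bregman \<psi> u x') + (e\<^sup>2 / 6 - d\<^sup>2 / 6)"
    proof -
      \<comment> \<open>Six times the claim. The weight 1/6 makes the coefficients of
        \<open>e\<^sup>2\<close> and \<open>d\<^sup>2\<close> opposite, so that they
        telescope.\<close>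
      have "0 \<le> (p - d)\<^sup>2 + (e - d)\<^sup>2 + 2 * p\<^sup>2"
        by simp
      then show ?thesis
        by (simp add: power2_eq_square algebra_simps)
    qed
    finally show ?thesis
      by (simp add: pdse)
  qed
qed

section \<open>Finiteness of \<open>G\<close>, bounded gradients and the rate\<close>

theorem theorem3p9:
  fixes N :: "'a::euclidean_space \<Rightarrow> real"
    and X :: "'a set"
    and f \<psi> :: "'a \<Rightarrow> real"
    and l :: "real \<Rightarrow> real"
    and xstar :: 'a
    and x y :: "nat \<Rightarrow> 'a"
    and G L \<eta> :: real
  assumes "is_norm N"
    and "open X" and "convex X"
    and "convex_on X f" and "closed_function X f"
    and "link_function l" and "sub_quadratic l"
    and "ell_star_smooth N l X f"
    and "mirror_map N X \<psi>"
    and "is_arg_min f (\<lambda>z. z \<in> X) xstar"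
    and "is_arg_min \<psi> (\<lambda>z. z \<in> X) (x 0)" and "y 0 = x 0"
    and "G = Sup {\<alpha>. 0 \<le> \<alpha> \<and> \<alpha>\<^sup>2 \<le> 2 * l (2 * \<alpha>) * (f (x 0) - f xstar)}"
    and "L = l (2 * G)"
    and "0 < \<eta>" and "\<eta> \<le> 1 / (3 * L)"
    and "\<And>t. 1 \<le> t \<Longrightarrow> y t \<in> prox X \<psi> (x (t - 1)) (\<eta> *\<^sub>R grad f (y (t - 1)))"
    and "\<And>t. 1 \<le> t \<Longrightarrow> x t \<in> prox X \<psi> (x (t - 1)) (\<eta> *\<^sub>R grad f (y t))"
  shows "(\<forall>t. max (dual_norm N (grad f (y t))) (dual_norm N (grad f (x t))) \<le> G) \<and>
         (\<forall>T\<ge>1. f ((1 / real T) *\<^sub>R (\<Sum>t=1..T. y t)) - f xstar \<le> bregman \<psi> xstar (x 0) / (\<eta> * real T))"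
proof -
  note N = assms(1) and mirror = assms(9)
  let ?D = "dual_norm N" and ?g = "grad f"
  note D = is_norm_dual_norm[OF N]
  have l_pos: "0 < l a" if "0 \<le> a" for a
    using assms(6) that by (simp add: link_function_def)
  have xstar: "xstar \<in> X" "\<And>z. z \<in> X \<Longrightarrow> f xstar \<le> f z"
    using assms(10) by (auto simp: is_arg_min_linorder)
  have x0: "x 0 \<in> X" "\<And>z. z \<in> X \<Longrightarrow> \<psi> (x 0) \<le> \<psi> z"
    using assms(11) by (auto simp: is_arg_min_linorder)
  then have "0 \<in> subdifferential X \<psi> (x 0)"
    by (simp add: subdifferential_def)
  then have x0_dom: "x 0 \<in> subdiff_domain X \<psi>"
    using x0(1) by (auto simp: subdiff_domain_def)

  define A where "A = {\<alpha>. 0 \<le> \<alpha> \<and> \<alpha>\<^sup>2 \<le> 2 * l (2 * \<alpha>) * (f (x 0) - f xstar)}"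
  have G: "G = Sup A"
    using assms(13) by (simp add: A_def)
  have "bdd_above A"
  proof -
    \<comment> \<open>Sub-quadratic growth is used at \<open>a = 2 * \<alpha>\<close>: the factor 4
      of \<open>(2 * \<alpha>)\<^sup>2\<close> and the 2 in \<open>A\<close> give 8.\<close>
    have "eventually (\<lambda>a. 8 * (f (x 0) - f xstar) < a\<^sup>2 / l a) at_top"
      using assms(7) unfolding sub_quadratic_def by (rule filterlim_at_top_dense[THEN iffD1, rule_format])
    then obtain b where b: "\<And>a. b \<le> a \<Longrightarrow> 8 * (f (x 0) - f xstar) < a\<^sup>2 / l a"
      by (auto simp: eventually_at_top_linorder)
    have "\<alpha> \<le> \<bar>b\<bar>" if \<alpha>: "\<alpha> \<in> A" for \<alpha>
    proof (rule ccontr)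
      assume "\<not> ?thesis"
      then have "b \<le> 2 * \<alpha>" "0 < l (2 * \<alpha>)"
        using l_pos[of "2 * \<alpha>"] by auto
      then have "8 * (f (x 0) - f xstar) * l (2 * \<alpha>) < (2 * \<alpha>)\<^sup>2"
        using b[of "2 * \<alpha>"] by (simp add: pos_less_divide_eq)
      then show False
        using \<alpha> by (simp add: A_def power2_eq_square algebra_simps)
    qed
    then show ?thesis
      by (rule bdd_aboveI)
  qed
  have sublevel: "?D (?g z) \<le> G" if "z \<in> X" "f z \<le> f (x 0)" for z
  proof -
    have "0 \<le> ?D (?g z)"
      by (rule is_norm_simps(1)[OF D])
    \<comment> \<open>The self-bounding inequality makes the gradient norm itself an element of
      \<open>A\<close>.\<close>
    have "(?D (?g z))\<^sup>2 \<le> 2 * l (2 * ?D (?g z)) * (f z - f xstar)"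
      using that(1) xstar(2) by (rule dual_norm_grad_sq_le[OF assms(1,2,6,8,5)])
    also have "\<dots> \<le> 2 * l (2 * ?D (?g z)) * (f (x 0) - f xstar)"
      using that(2) l_pos[of "2 * ?D (?g z)"] \<open>0 \<le> ?D (?g z)\<close> by (intro mult_left_mono) auto
    finally have "?D (?g z) \<in> A"
      using \<open>0 \<le> ?D (?g z)\<close> by (simp add: A_def)
    then show ?thesis
      unfolding G using \<open>bdd_above A\<close> by (rule cSup_upper)
  qed
  have "0 \<le> G"
    using sublevel[OF x0(1)] is_norm_simps(1)[OF D] order_trans by blast
  then have "0 < L"
    using l_pos assms(14) by simp
  then have \<eta>: "3 * L * \<eta> \<le> 1"
    using assms(16) by (simp add: field_simps)

  note step = optimistic_mirror_descent_step[OF assms(1-4,6,8,9,14,15) \<eta>, where c = "f (x 0)"]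
  have inv: "x t \<in> subdiff_domain X \<psi> \<and> y t \<in> subdiff_domain X \<psi> \<and> ?D (?g (y t)) \<le> G \<and>
    3 * L * N (x t - y t) \<le> 2 * G \<and> f (x t) + L * (N (x t - y t))\<^sup>2 \<le> f (x 0)" for t
  proof (induction t)
    case 0
    show ?case
      using x0_dom assms(12) sublevel[OF x0(1)] \<open>0 \<le> G\<close> by (simp add: is_norm_simps(3)[OF N])
  next
    case (Suc t)
    have "y (Suc t) \<in> prox X \<psi> (x t) (\<eta> *\<^sub>R ?g (y t))" "x (Suc t) \<in> prox X \<psi> (x t) (\<eta> *\<^sub>R ?g (y (Suc t)))"
      using assms(17)[of "Suc t"] assms(18)[of "Suc t"] by simp_all
    then show ?case
      using step(1-5)[where x = "x t" and y = "y t"] sublevel Suc.IH by blast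
  qed
  have regret_step: "\<eta> * (f (y (Suc t)) - f xstar) \<le> (bregman \<psi> xstar (x t) - bregman \<psi> xstar (x (Suc t)))
      + ((N (x t - y t))\<^sup>2 / 6 - (N (x (Suc t) - y (Suc t)))\<^sup>2 / 6)" for t
    using inv[of t] assms(17)[of "Suc t"] assms(18)[of "Suc t"] sublevel xstar(1)
    by (intro step(6)) simp_all
  \<comment> \<open>The sum starts with a zero distance term because
    \<open>y 0 = x 0\<close>.\<close>
  have regret: "\<eta> * (\<Sum>t=1..T. f (y t) - f xstar) \<le>
      bregman \<psi> xstar (x 0) - bregman \<psi> xstar (x T) - (N (x T - y T))\<^sup>2 / 6" for T
  proof (induction T)
    case 0
    show ?case
      using assms(12) by (simp add: is_norm_simps(3)[OF N])
  next
    case (Suc T)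
    then show ?case
      using regret_step[of T] by (simp add: distrib_left)
  qed

  have "max (?D (?g (y t))) (?D (?g (x t))) \<le> G" for t
  proof -
    have "0 \<le> L * (N (x t - y t))\<^sup>2"
      using \<open>0 < L\<close> by simp
    then have "f (x t) \<le> f (x 0)"
      using inv[of t] by linarith
    then show ?thesis
      using inv[of t] sublevel[of "x t"] by (simp add: subdiff_domain_def)
  qed
  moreover have "f ((1 / real T) *\<^sub>R (\<Sum>t=1..T. y t)) - f xstar \<le> bregman \<psi> xstar (x 0) / (\<eta> * real T)"
    if T: "1 \<le> T" for T
  proof -
    have "f (\<Sum>t=1..T. (1 / real T) *\<^sub>R y t) \<le> (\<Sum>t=1..T. 1 / real T * f (y t))"
      using T inv by (intro convex_on_sum[OF _ _ assms(4)]) (auto simp: subdiff_domain_def)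
    then have "f ((1 / real T) *\<^sub>R (\<Sum>t=1..T. y t)) \<le> (\<Sum>t=1..T. f (y t)) / real T"
      by (simp add: scaleR_sum_right sum_divide_distrib)
    also have "\<dots> = (\<Sum>t=1..T. f (y t) - f xstar) / real T + f xstar"
      using T by (simp add: sum_subtractf diff_divide_distrib)
    also have "\<dots> \<le> bregman \<psi> xstar (x 0) / (\<eta> * real T) + f xstar"
    proof -
      have "0 \<le> bregman \<psi> xstar (x T)"
        using bregman_nonneg[OF assms(2) mirror _ xstar(1)] inv by blast
      moreover have "0 \<le> (N (x T - y T))\<^sup>2 / 6"
        by simp
      ultimately have "\<eta> * (\<Sum>t=1..T. f (y t) - f xstar) \<le> bregman \<psi> xstar (x 0)"
        using regret[of T] by linarith
      then have "(\<Sum>t=1..T. f (y t) - f xstar) \<le> bregman \<psi> xstar (x 0) / \<eta>"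
        using assms(15) by (simp add: pos_le_divide_eq mult.commute)
      then show ?thesis
        using T by (simp add: divide_right_mono flip: divide_divide_eq_left)
    qed
    finally show ?thesis
      by simp
  qed
  ultimately show ?thesis
    by blast
qed

end
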